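(* (1) For every neighborhood-ordinal injection $\iota:(S,\Gamma,\preceq)\to(S',\Gamma',\preceq')$, the map $\iota$ is an edge-expansive homomorphism from $\mathcal{L}(S,\Gamma,\preceq)$ to $\mathcal{L}(S',\Gamma',\preceq')$. Consequently, $\mathcal{L}$ is a functor from the category $\mathbf{OOD}$ of out-ordered digraphs with neighborhood-ordinal injections to the category $\mathbf{WGra}$ of edge-weighted graphs with edge-expansive homomorphisms, where $\mathcal{L}$ is defined on objects as in the context and on morphisms by $\mathcal{L}(\iota)=\iota$. (2) For every out-ordered digraph $(S,\Gamma,\preceq)$, forget the weights of $\mathcal{L}(S,\Gamma,\preceq)$ and view the resulting graph as a symmetric digraph by replacing each edge $\{x,y\}$ with the arcs $(x,y)$ and $(y,x)$. The result equals the symmetric interior of the digraph $F(S,\Gamma,\preceq)$, namely the digraph on $S$ with arcs $\{(x,y): y\in\Gamma(x)\text{ and }x\in\Gamma(y)\}$. This identification holds on morphisms as well: both sides send $\iota$ to $\iota$.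
   Context: Out-ordered digraphs. An out-ordered digraph is $(S,\Gamma,\preceq)$ where: - $S$ is a set; - $\Gamma:S\to\mathcal{P}(S)$ is a function; - $\preceq_x$ is a partial order on $\Gamma(x)$ for each $x\in S$. We write $\prec_x$ for the strict part of $\preceq_x$. The digraph $F(S,\Gamma,\preceq)$ has vertex set $S$ and arcs $\{(x,y): y\in\Gamma(x)\}$. Neighborhood-ordinal injections. A neighborhood-ordinal injection $\iota:(S,\Gamma,\preceq)\to(S',\Gamma',\preceq')$ is an injective function $\iota:S\to S'$ such that: - $y\in\Gamma(x)$ implies $\iota(y)\in\Gamma'(\iota(x))$; - $y\preceq_x z$ implies $\iota(y)\preceq'_{\iota(x)}\iota(z)$; - for all $x\in S$ and $w\in\Gamma'(\iota(x))\setminus\iota(\Gamma(x))$, we have $\iota(y)\prec'_{\iota(x)}w$ for all $y\in\Gamma(x)$. Edge-weighted graphs. Graphs are undirected and may have loops. An edge-weighted graph is a graph $G$ with $w:E(G)\to[0,\infty]$. An edge-expansive homomorphism $(G,w)\to(G',w')$ is a map $f:V(G)\to V(G')$ such that every edge $\{x,y\}$ of $G$ satisfies: - $\{f(x),f(y)\}\in E(G')$, and - $w(\{x,y\})\le w'(\{f(x),f(y)\})$. Mutual friends. $x,z$ are mutual friends if $z\in\Gamma(x)$ and $x\in\Gamma(z)$. Third-wheels. $$\mathscr{F}(x,z)=\{y: x,z\in\Gamma(y)\}\cup\{y: y\in\Gamma(x),z\in\Gamma(y)\}\cup\{y: x\in\Gamma(y),y\in\Gamma(z)\}.$$ The set $\mathscr{G}$.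 For mutual friends $x,z$, $$\mathscr{G}(x,z)=\{y\in\mathscr{F}(x,z): (y\in\Gamma(x)\Rightarrow z\prec_x y)\text{ and }(y\in\Gamma(z)\Rightarrow x\prec_z y)\}.$$ Linkage graph. $\mathcal{L}(S,\Gamma,\preceq)$ is the edge-weighted graph with vertex set $S$, edges the pairs $\{x,z\}$ of mutual friends, and weight (in-sway) $\sigma(\{x,z\})=\operatorname{card}\mathscr{G}(x,z)\in[0,\infty]$. *)

theory Defs
  imports
    "HOL-Library.FuncSet"
    "HOL-Library.Extended_Nonnegative_Real"
    "Graph_Theory.Pair_Digraph"
begin

section \<open>Categories and functors\<close>

text \<open>
  Categories with indexed hom-sets, so that a morphism need not remember its domain and codomain:
  \<open>Comp C X Y Z g f\<close> is the composite of \<open>f \<in> Hom C X Y\<close> and \<open>g \<in> Hom C Y Z\<close>.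
\<close>

record ('o, 'm) category =
  Obj :: "'o set"
  Hom :: "'o \<Rightarrow> 'o \<Rightarrow> 'm set"
  Ident :: "'o \<Rightarrow> 'm"
  Comp :: "'o \<Rightarrow> 'o \<Rightarrow> 'o \<Rightarrow> 'm \<Rightarrow> 'm \<Rightarrow> 'm"

definition is_category :: "('o, 'm) category \<Rightarrow> bool" where
  "is_category C \<longleftrightarrow>
     (\<forall>X\<in>Obj C. Ident C X \<in> Hom C X X) \<and>
     (\<forall>X\<in>Obj C. \<forall>Y\<in>Obj C. \<forall>Z\<in>Obj C. \<forall>f\<in>Hom C X Y. \<forall>g\<in>Hom C Y Z.
        Comp C X Y Z g f \<in> Hom C X Z) \<and>
     (\<forall>X\<in>Obj C. \<forall>Y\<in>Obj C. \<forall>f\<in>Hom C X Y.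
        Comp C X X Y f (Ident C X) = f \<and> Comp C X Y Y (Ident C Y) f = f) \<and>
     (\<forall>W\<in>Obj C. \<forall>X\<in>Obj C. \<forall>Y\<in>Obj C. \<forall>Z\<in>Obj C.
        \<forall>f\<in>Hom C W X. \<forall>g\<in>Hom C X Y. \<forall>h\<in>Hom C Y Z.
        Comp C W Y Z h (Comp C W X Y g f) = Comp C W X Z (Comp C X Y Z h g) f)"

record ('o, 'm, 'p, 'n) functor_data =
  ObMap :: "'o \<Rightarrow> 'p"
  MorMap :: "'o \<Rightarrow> 'o \<Rightarrow> 'm \<Rightarrow> 'n"

definition is_functor ::
  "('o, 'm) category \<Rightarrow> ('p, 'n) category \<Rightarrow> ('o, 'm, 'p, 'n) functor_data \<Rightarrow> bool" where
  "is_functor C D F \<longleftrightarrow>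
     is_category C \<and> is_category D \<and>
     (\<forall>X\<in>Obj C. ObMap F X \<in> Obj D) \<and>
     (\<forall>X\<in>Obj C. \<forall>Y\<in>Obj C. \<forall>f\<in>Hom C X Y.
        MorMap F X Y f \<in> Hom D (ObMap F X) (ObMap F Y)) \<and>
     (\<forall>X\<in>Obj C. MorMap F X X (Ident C X) = Ident D (ObMap F X)) \<and>
     (\<forall>X\<in>Obj C. \<forall>Y\<in>Obj C. \<forall>Z\<in>Obj C. \<forall>f\<in>Hom C X Y. \<forall>g\<in>Hom C Y Z.
        MorMap F X Z (Comp C X Y Z g f) =
        Comp D (ObMap F X) (ObMap F Y) (ObMap F Z) (MorMap F Y Z g) (MorMap F X Y f))"

definition functor_comp ::
  "('p, 'n, 'q, 'k) functor_data \<Rightarrow> ('o, 'm, 'p, 'n) functor_data \<Rightarrow> ('o, 'm, 'q, 'k) functor_data"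
  (infixr "\<circ>\<^sub>F" 55) where
  "G \<circ>\<^sub>F F = \<lparr>ObMap = (\<lambda>X. ObMap G (ObMap F X)),
             MorMap = (\<lambda>X Y f. MorMap G (ObMap F X) (ObMap F Y) (MorMap F X Y f))\<rparr>"

text \<open>Functors are total functions on the underlying types; only their values on \<open>C\<close> matter.\<close>

definition functors_agree ::
  "('o, 'm) category \<Rightarrow> ('o, 'm, 'p, 'n) functor_data \<Rightarrow> ('o, 'm, 'p, 'n) functor_data \<Rightarrow> bool" where
  "functors_agree C F G \<longleftrightarrow>
     (\<forall>X\<in>Obj C. ObMap F X = ObMap G X) \<and>
     (\<forall>X\<in>Obj C. \<forall>Y\<in>Obj C. \<forall>f\<in>Hom C X Y. MorMap F X Y f = MorMap G X Y f)"

text \<open>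
  The concrete categories below consist of structures on sets, with a class of structure-preserving
  maps. Morphisms are extensional functions, so that equality of morphisms is equality on the
  underlying set.
\<close>

definition concrete_category ::
  "'o set \<Rightarrow> ('o \<Rightarrow> 'a set) \<Rightarrow> ('o \<Rightarrow> 'o \<Rightarrow> ('a \<Rightarrow> 'a) \<Rightarrow> bool) \<Rightarrow> ('o, 'a \<Rightarrow> 'a) category" where
  "concrete_category Ob U P =
     \<lparr>Obj = Ob,
      Hom = (\<lambda>X Y. {f \<in> extensional (U X). P X Y f}),
      Ident = (\<lambda>X. \<lambda>x\<in>U X. x),
      Comp = (\<lambda>X Y Z g f. compose (U X) g f)\<rparr>"


section \<open>Out-ordered digraphs\<close>

text \<open>
  \<open>(y, z) \<in> out_ord D x\<close> encodes \<open>y \<preceq>\<^sub>x z\<close>. Both \<open>out_nbrs\<close> and \<open>out_ord\<close> are functions on the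
  vertex set only and hence required to be extensional.
\<close>

record 'a ood =
  ood_verts :: "'a set"
  out_nbrs :: "'a \<Rightarrow> 'a set"
  out_ord :: "'a \<Rightarrow> 'a rel"

definition out_ordered_digraph :: "'a ood \<Rightarrow> bool" where
  "out_ordered_digraph D \<longleftrightarrow>
     out_nbrs D \<in> ood_verts D \<rightarrow>\<^sub>E Pow (ood_verts D) \<and>
     out_ord D \<in> extensional (ood_verts D) \<and>
     (\<forall>x\<in>ood_verts D. partial_order_on (out_nbrs D x) (out_ord D x))"

definition out_less :: "'a ood \<Rightarrow> 'a \<Rightarrow> 'a \<Rightarrow> 'a \<Rightarrow> bool" where
  "out_less D x y z \<longleftrightarrow> (y, z) \<in> out_ord D x \<and> y \<noteq> z"

definition nbhd_ordinal_injection :: "'a ood \<Rightarrow> 'b ood \<Rightarrow> ('a \<Rightarrow> 'b) \<Rightarrow> bool" where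
  "nbhd_ordinal_injection D D' \<iota> \<longleftrightarrow>
     \<iota> \<in> ood_verts D \<rightarrow> ood_verts D' \<and> inj_on \<iota> (ood_verts D) \<and>
     (\<forall>x\<in>ood_verts D. \<forall>y\<in>out_nbrs D x. \<iota> y \<in> out_nbrs D' (\<iota> x)) \<and>
     (\<forall>x\<in>ood_verts D. \<forall>y z. (y, z) \<in> out_ord D x \<longrightarrow> (\<iota> y, \<iota> z) \<in> out_ord D' (\<iota> x)) \<and>
     (\<forall>x\<in>ood_verts D. \<forall>w\<in>out_nbrs D' (\<iota> x) - \<iota> ` out_nbrs D x.
        \<forall>y\<in>out_nbrs D x. out_less D' (\<iota> x) (\<iota> y) w)"

definition OOD :: "('a ood, 'a \<Rightarrow> 'a) category" where
  "OOD = concrete_category {D. out_ordered_digraph D} ood_verts nbhd_ordinal_injection"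


section \<open>Graphs, edge-weighted graphs and digraphs\<close>

text \<open>An edge is a set \<open>{x, y}\<close> of vertices; a loop at \<open>x\<close> is the singleton \<open>{x}\<close>.\<close>

record 'a ugraph =
  gverts :: "'a set"
  gedges :: "'a set set"

record 'a wgraph = "'a ugraph" +
  gweight :: "'a set \<Rightarrow> ennreal"

definition is_graph :: "('a, 'r) ugraph_scheme \<Rightarrow> bool" where
  "is_graph G \<longleftrightarrow> (\<forall>e\<in>gedges G. \<exists>x\<in>gverts G. \<exists>y\<in>gverts G. e = {x, y})"

definition edge_weighted_graph :: "'a wgraph \<Rightarrow> bool" where
  "edge_weighted_graph G \<longleftrightarrow> is_graph G \<and> gweight G \<in> extensional (gedges G)"

definition edge_expansive_hom :: "'a wgraph \<Rightarrow> 'b wgraph \<Rightarrow> ('a \<Rightarrow> 'b) \<Rightarrow> bool" where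
  "edge_expansive_hom G G' f \<longleftrightarrow>
     f \<in> gverts G \<rightarrow> gverts G' \<and>
     (\<forall>x y. {x, y} \<in> gedges G \<longrightarrow>
        {f x, f y} \<in> gedges G' \<and> gweight G {x, y} \<le> gweight G' {f x, f y})"

definition WGra :: "('a wgraph, 'a \<Rightarrow> 'a) category" where
  "WGra = concrete_category {G. edge_weighted_graph G} gverts edge_expansive_hom"

definition digraph_hom :: "'a pair_pre_digraph \<Rightarrow> 'b pair_pre_digraph \<Rightarrow> ('a \<Rightarrow> 'b) \<Rightarrow> bool" where
  "digraph_hom G G' f \<longleftrightarrow>
     f \<in> pverts G \<rightarrow> pverts G' \<and> (\<forall>(x, y)\<in>parcs G. (f x, f y) \<in> parcs G')"

definition SymDigra :: "('a pair_pre_digraph, 'a \<Rightarrow> 'a) category" where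
  "SymDigra = concrete_category {G. sym_digraph (with_proj G)} pverts digraph_hom"


section \<open>The linkage graph\<close>

definition mutual_friends :: "'a ood \<Rightarrow> 'a \<Rightarrow> 'a \<Rightarrow> bool" where
  "mutual_friends D x z \<longleftrightarrow>
     x \<in> ood_verts D \<and> z \<in> ood_verts D \<and> z \<in> out_nbrs D x \<and> x \<in> out_nbrs D z"

definition third_wheels :: "'a ood \<Rightarrow> 'a \<Rightarrow> 'a \<Rightarrow> 'a set" where
  "third_wheels D x z =
     {y \<in> ood_verts D. x \<in> out_nbrs D y \<and> z \<in> out_nbrs D y} \<union>
     {y \<in> ood_verts D. y \<in> out_nbrs D x \<and> z \<in> out_nbrs D y} \<union>
     {y \<in> ood_verts D. x \<in> out_nbrs D y \<and> y \<in> out_nbrs D z}"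

definition G_set :: "'a ood \<Rightarrow> 'a \<Rightarrow> 'a \<Rightarrow> 'a set" where
  "G_set D x z =
     {y \<in> third_wheels D x z.
        (y \<in> out_nbrs D x \<longrightarrow> out_less D x z y) \<and> (y \<in> out_nbrs D z \<longrightarrow> out_less D z x y)}"

definition ecard :: "'a set \<Rightarrow> ennreal" where
  "ecard A = (if finite A then of_nat (card A) else \<infinity>)"

definition in_sway :: "'a ood \<Rightarrow> 'a set \<Rightarrow> ennreal" where
  "in_sway D e = (THE c. \<exists>x z. e = {x, z} \<and> c = ecard (G_set D x z))"

lemma G_set_commute: "G_set D x z = G_set D z x"
  by (auto simp: G_set_def third_wheels_def)

lemma in_sway_pair: "in_sway D {x, z} = ecard (G_set D x z)"
  unfolding in_sway_def
  by (rule the_equality) (auto simp: doubleton_eq_iff intro: arg_cong[OF G_set_commute])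

definition linkage_graph :: "'a ood \<Rightarrow> 'a wgraph" where
  "linkage_graph D =
     \<lparr>gverts = ood_verts D,
      gedges = {{x, z} | x z. mutual_friends D x z},
      gweight = restrict (in_sway D) {{x, z} | x z. mutual_friends D x z}\<rparr>"


section \<open>The functors\<close>

text \<open>All functors here act as the identity on underlying sets and maps.\<close>

definition Linkage :: "('a ood, 'a \<Rightarrow> 'a, 'a wgraph, 'a \<Rightarrow> 'a) functor_data" where
  "Linkage = \<lparr>ObMap = linkage_graph, MorMap = (\<lambda>_ _ \<iota>. \<iota>)\<rparr>"

definition forget_weights :: "'a wgraph \<Rightarrow> 'a ugraph" where
  "forget_weights G = \<lparr>gverts = gverts G, gedges = gedges G\<rparr>"

definition Forget :: "('a wgraph, 'a \<Rightarrow> 'a, 'a ugraph, 'a \<Rightarrow> 'a) functor_data" where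
  "Forget = \<lparr>ObMap = forget_weights, MorMap = (\<lambda>_ _ f. f)\<rparr>"

definition symmetric_digraph :: "'a ugraph \<Rightarrow> 'a pair_pre_digraph" where
  "symmetric_digraph G = \<lparr>pverts = gverts G, parcs = {(x, y). {x, y} \<in> gedges G}\<rparr>"

definition AsSymmetric :: "('a ugraph, 'a \<Rightarrow> 'a, 'a pair_pre_digraph, 'a \<Rightarrow> 'a) functor_data" where
  "AsSymmetric = \<lparr>ObMap = symmetric_digraph, MorMap = (\<lambda>_ _ f. f)\<rparr>"

definition ood_digraph :: "'a ood \<Rightarrow> 'a pair_pre_digraph" where
  "ood_digraph D = \<lparr>pverts = ood_verts D, parcs = {(x, y). x \<in> ood_verts D \<and> y \<in> out_nbrs D x}\<rparr>"

definition Digraph_of :: "('a ood, 'a \<Rightarrow> 'a, 'a pair_pre_digraph, 'a \<Rightarrow> 'a) functor_data" where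
  "Digraph_of = \<lparr>ObMap = ood_digraph, MorMap = (\<lambda>_ _ \<iota>. \<iota>)\<rparr>"

definition symmetric_interior :: "'a pair_pre_digraph \<Rightarrow> 'a pair_pre_digraph" where
  "symmetric_interior G =
     \<lparr>pverts = pverts G, parcs = {(x, y). (x, y) \<in> parcs G \<and> (y, x) \<in> parcs G}\<rparr>"

definition SymInterior ::
  "('a pair_pre_digraph, 'a \<Rightarrow> 'a, 'a pair_pre_digraph, 'a \<Rightarrow> 'a) functor_data" where
  "SymInterior = \<lparr>ObMap = symmetric_interior, MorMap = (\<lambda>_ _ f. f)\<rparr>"

end

(* A third-wheel y counted by G(x,z) maps to one counted by G(\<iota> x, \<iota> z): if \<iota> y is an out-neighbour
   of \<iota> x, either y is already an out-neighbour of x, so that the inequality between z and y is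
   transported, or \<iota> y is a new out-neighbour, which lies above all old ones and hence above \<iota> z.
   So \<iota> embeds G(x,z) into G(\<iota> x, \<iota> z), and the in-sway can only grow. *)

theory Submission
  imports Defs
begin

section \<open>Concrete categories\<close>

text \<open>Extensional functions that map carriers to carriers satisfy the identity and
  associativity laws whatever \<open>P\<close> is. Only closure of \<open>P\<close> under restricted
  identities and composites depends on the structures.\<close>

lemma is_category_concrete_category:
  assumes funcset: "\<And>X Y f. X \<in> Ob \<Longrightarrow> Y \<in> Ob \<Longrightarrow> P X Y f \<Longrightarrow> f \<in> U X \<rightarrow> U Y"
    and ident: "\<And>X. X \<in> Ob \<Longrightarrow> P X X (\<lambda>x\<in>U X. x)"
    and comp: "\<And>X Y Z f g. X \<in> Ob \<Longrightarrow> Y \<in> Ob \<Longrightarrow> Z \<in> Ob \<Longrightarrow> P X Y f \<Longrightarrow> P Y Z g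
                 \<Longrightarrow> P X Z (compose (U X) g f)"
  shows "is_category (concrete_category Ob U P)"
  unfolding is_category_def concrete_category_def
  using ident comp
  by (auto simp: compose_Id[OF funcset] Id_compose[OF funcset] intro!: compose_assoc[OF funcset])

text \<open>Identities and composites are formed by restricting to the carrier, which
  \<open>F\<close> keeps. As \<open>F\<close> also fixes each map, functoriality comes down to
  \<open>P\<close> implying \<open>P'\<close>.\<close>

lemma is_functor_concrete_category:
  assumes "is_category (concrete_category Ob U P)" "is_category (concrete_category Ob' U' P')"
    and "\<And>X. X \<in> Ob \<Longrightarrow> ObMap F X \<in> Ob'"
    and "\<And>X. X \<in> Ob \<Longrightarrow> U' (ObMap F X) = U X"
    and "MorMap F = (\<lambda>_ _ f. f)"
    and "\<And>X Y f. X \<in> Ob \<Longrightarrow> Y \<in> Ob \<Longrightarrow> P X Y f \<Longrightarrow> P' (ObMap F X) (ObMap F Y) f"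
  shows "is_functor (concrete_category Ob U P) (concrete_category Ob' U' P') F"
  using assms unfolding is_functor_def by (simp add: concrete_category_def)

section \<open>The three categories\<close>

lemma out_ordered_digraph_nbrs:
  "out_ordered_digraph D \<Longrightarrow> x \<in> ood_verts D \<Longrightarrow> y \<in> out_nbrs D x \<Longrightarrow> y \<in> ood_verts D"
  by (auto simp: out_ordered_digraph_def)

text \<open>A partial order on a set is a subset of its square. This recovers the memberships that
  the monotonicity clause of \<open>nbhd_ordinal_injection\<close> does not mention.\<close>

lemma out_ordered_digraph_ord:
  assumes "out_ordered_digraph D" "x \<in> ood_verts D" "(y, z) \<in> out_ord D x"
  shows "y \<in> out_nbrs D x" "z \<in> out_nbrs D x"
  using assms partial_order_onD(4)[of "out_nbrs D x" "out_ord D x"]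
  by (auto simp: out_ordered_digraph_def)

context
  fixes D :: "'a ood" and D' :: "'b ood" and f
  assumes f: "nbhd_ordinal_injection D D' f"
begin

lemma nbhd_ordinal_injection_verts: "x \<in> ood_verts D \<Longrightarrow> f x \<in> ood_verts D'"
  using f by (auto simp: nbhd_ordinal_injection_def)

lemma nbhd_ordinal_injection_eq_iff:
  "x \<in> ood_verts D \<Longrightarrow> y \<in> ood_verts D \<Longrightarrow> f x = f y \<longleftrightarrow> x = y"
  using f by (auto simp: nbhd_ordinal_injection_def inj_on_def)

lemma nbhd_ordinal_injection_nbrs:
  "x \<in> ood_verts D \<Longrightarrow> y \<in> out_nbrs D x \<Longrightarrow> f y \<in> out_nbrs D' (f x)"
  using f by (auto simp: nbhd_ordinal_injection_def)

lemma nbhd_ordinal_injection_ord: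
  "x \<in> ood_verts D \<Longrightarrow> (y, z) \<in> out_ord D x \<Longrightarrow> (f y, f z) \<in> out_ord D' (f x)"
  using f by (auto simp: nbhd_ordinal_injection_def)

lemma nbhd_ordinal_injection_new:
  "x \<in> ood_verts D \<Longrightarrow> w \<in> out_nbrs D' (f x) \<Longrightarrow> w \<notin> f ` out_nbrs D x \<Longrightarrow> y \<in> out_nbrs D x
    \<Longrightarrow> out_less D' (f x) (f y) w"
  using f by (auto simp: nbhd_ordinal_injection_def)

text \<open>The definition transports only the weak order; strictness survives because comparable
  elements are vertices, where \<open>f\<close> is injective.\<close>

lemma nbhd_ordinal_injection_less:
  assumes "out_ordered_digraph D" "x \<in> ood_verts D" "out_less D x y z"
  shows "out_less D' (f x) (f y) (f z)"
proof -
  have yz: "(y, z) \<in> out_ord D x" "y \<noteq> z"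
    using assms(3) by (auto simp: out_less_def)
  then have "y \<in> ood_verts D" "z \<in> ood_verts D"
    using out_ordered_digraph_ord[OF assms(1,2)] out_ordered_digraph_nbrs[OF assms(1,2)] by auto
  then show ?thesis
    using yz nbhd_ordinal_injection_ord[OF assms(2)]
    by (simp add: out_less_def nbhd_ordinal_injection_eq_iff)
qed

end

lemma nbhd_ordinal_injection_restrict_id:
  assumes "out_ordered_digraph D"
  shows "nbhd_ordinal_injection D D (\<lambda>x\<in>ood_verts D. x)"
proof -
  \<comment> \<open>The identity creates no new out-neighbours, so the last clause of the definition
    is vacuous.\<close>
  have "out_nbrs D x \<subseteq> (\<lambda>x\<in>ood_verts D. x) ` out_nbrs D x" if "x \<in> ood_verts D" for x
    using that out_ordered_digraph_nbrs[OF assms] by force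
  then show ?thesis
    unfolding nbhd_ordinal_injection_def
    using out_ordered_digraph_nbrs[OF assms] out_ordered_digraph_ord[OF assms]
    by (auto simp: inj_on_def)
qed

text \<open>The clause on new out-neighbours is the substantial one: an out-neighbour
  \<open>w\<close> of \<open>g (f x)\<close> that is new for the composite is either the
  \<open>g\<close>-image of one new for \<open>f\<close>, or new for \<open>g\<close>
  itself.\<close>

lemma nbhd_ordinal_injection_compose:
  assumes D: "out_ordered_digraph D" "out_ordered_digraph D'"
    and f: "nbhd_ordinal_injection D D' f" and g: "nbhd_ordinal_injection D' D'' g"
  shows "nbhd_ordinal_injection D D'' (compose (ood_verts D) g f)"
proof -
  note verts = nbhd_ordinal_injection_verts[OF f] nbhd_ordinal_injection_verts[OF g]
  note nbrs = out_ordered_digraph_nbrs[OF D(1)]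
  have c: "compose (ood_verts D) g f x = g (f x)" if "x \<in> ood_verts D" for x
    using that by (rule compose_eq)
  have new: "out_less D'' (g (f x)) (g (f y)) w"
    if x: "x \<in> ood_verts D" and w: "w \<in> out_nbrs D'' (g (f x))"
      and nw: "w \<notin> (\<lambda>x. g (f x)) ` out_nbrs D x" and y: "y \<in> out_nbrs D x" for x y w
  proof (cases "w \<in> g ` out_nbrs D' (f x)")
    case True
    then obtain v where v: "v \<in> out_nbrs D' (f x)" "w = g v" by auto
    with nw have "v \<notin> f ` out_nbrs D x" by auto
    \<comment> \<open>Here \<open>v\<close> is new for \<open>f\<close>, so it lies strictly above
      \<open>f y\<close>; \<open>g\<close> then transports this strict inequality.\<close>
    then have "out_less D' (f x) (f y) v"
      using nbhd_ordinal_injection_new[OF f] x v y by blast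
    then show ?thesis
      using nbhd_ordinal_injection_less[OF g D(2)] verts x v by blast
  next
    case False
    \<comment> \<open>Here \<open>w\<close> is new for \<open>g\<close>, whereas \<open>f y\<close>
      is an out-neighbour of \<open>f x\<close>, so the clause for \<open>g\<close> applies
      directly.\<close>
    then show ?thesis
      using nbhd_ordinal_injection_new[OF g] nbhd_ordinal_injection_nbrs[OF f] verts x w y by blast
  qed
  \<comment> \<open>Out-neighbours are vertices, so restricting the composite to vertices does not
    change this image.\<close>
  have img: "compose (ood_verts D) g f ` out_nbrs D x = (\<lambda>x. g (f x)) ` out_nbrs D x"
    if "x \<in> ood_verts D" for x
    using nbrs[OF that] by (intro image_cong) (auto simp: c)
  have "inj_on (compose (ood_verts D) g f) (ood_verts D)"
    by (auto simp: inj_on_def c verts nbhd_ordinal_injection_eq_iff[OF f]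
        nbhd_ordinal_injection_eq_iff[OF g])
  moreover have "(compose (ood_verts D) g f y, compose (ood_verts D) g f z)
      \<in> out_ord D'' (compose (ood_verts D) g f x)"
    if "x \<in> ood_verts D" "(y, z) \<in> out_ord D x" for x y z
    using that nbrs out_ordered_digraph_ord[OF D(1) that] verts
    by (simp add: c nbhd_ordinal_injection_ord[OF f] nbhd_ordinal_injection_ord[OF g])
  ultimately show ?thesis
    unfolding nbhd_ordinal_injection_def
    using verts nbrs new
    by (simp add: c img nbhd_ordinal_injection_nbrs[OF f] nbhd_ordinal_injection_nbrs[OF g])
qed

lemma is_category_OOD: "is_category OOD"
  unfolding OOD_def
proof (rule is_category_concrete_category)
  show "f \<in> ood_verts X \<rightarrow> ood_verts Y" if "nbhd_ordinal_injection X Y f" for X Y :: "'a ood" and f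
    using that by (simp add: nbhd_ordinal_injection_def)
qed (auto intro: nbhd_ordinal_injection_restrict_id nbhd_ordinal_injection_compose)

text \<open>Restricted identities and composites can be evaluated only at vertices; this supplies
  that fact for the ends of an edge.\<close>

lemma is_graph_edgeD:
  assumes "is_graph G" "{x, y} \<in> gedges G"
  shows "x \<in> gverts G" "y \<in> gverts G"
  using assms by (auto simp: is_graph_def doubleton_eq_iff dest!: bspec)

lemma is_category_WGra: "is_category WGra"
  unfolding WGra_def
proof (rule is_category_concrete_category)
  show "f \<in> gverts X \<rightarrow> gverts Y" if "edge_expansive_hom X Y f" for X Y :: "'a wgraph" and f
    using that by (simp add: edge_expansive_hom_def)
next
  fix X :: "'a wgraph"
  assume "X \<in> {G. edge_weighted_graph G}"
  then have "is_graph X"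
    by (simp add: edge_weighted_graph_def)
  then show "edge_expansive_hom X X (\<lambda>x\<in>gverts X. x)"
    by (auto simp: edge_expansive_hom_def dest: is_graph_edgeD)
next
  fix X Y Z :: "'a wgraph" and f g
  assume "X \<in> {G. edge_weighted_graph G}"
    and f: "edge_expansive_hom X Y f" and g: "edge_expansive_hom Y Z g"
  then have X: "is_graph X"
    by (simp add: edge_weighted_graph_def)
  have "{g (f x), g (f y)} \<in> gedges Z \<and> gweight X {x, y} \<le> gweight Z {g (f x), g (f y)}"
    if "{x, y} \<in> gedges X" for x y
    using f g that unfolding edge_expansive_hom_def by (meson order_trans)
  moreover have "compose (gverts X) g f \<in> gverts X \<rightarrow> gverts Z"
    using f g unfolding edge_expansive_hom_def by (metis funcset_compose)
  ultimately show "edge_expansive_hom X Z (compose (gverts X) g f)"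
    using is_graph_edgeD[OF X] by (simp add: edge_expansive_hom_def compose_eq)
qed

text \<open>The arcs of \<open>with_proj G\<close> are pairs whose tail and head are their
  projections, so well-formedness and symmetry become conditions on the relation
  \<open>parcs G\<close>.\<close>

lemma sym_digraph_with_proj_iff:
  "sym_digraph (with_proj G) \<longleftrightarrow> parcs G \<subseteq> pverts G \<times> pverts G \<and> sym (parcs G)"
  by (auto simp: sym_digraph_def sym_digraph_axioms_def wf_digraph_def symmetric_def)

lemma is_category_SymDigra: "is_category SymDigra"
  unfolding SymDigra_def
proof (rule is_category_concrete_category)
  show "f \<in> pverts X \<rightarrow> pverts Y" if "digraph_hom X Y f" for X Y :: "'a pair_pre_digraph" and f
    using that by (simp add: digraph_hom_def)
qed (fastforce simp: digraph_hom_def sym_digraph_with_proj_iff compose_eq)+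

section \<open>The linkage graph\<close>

lemma mutual_friends_image:
  "nbhd_ordinal_injection D D' f \<Longrightarrow> mutual_friends D x z \<Longrightarrow> mutual_friends D' (f x) (f z)"
  by (simp add: mutual_friends_def nbhd_ordinal_injection_verts nbhd_ordinal_injection_nbrs)

text \<open>Each of the three patterns consists of arcs alone, and \<open>f\<close> preserves arcs;
  the orders enter only in \<open>G_set\<close>.\<close>

lemma third_wheels_image:
  assumes "nbhd_ordinal_injection D D' f" "mutual_friends D x z" "y \<in> third_wheels D x z"
  shows "f y \<in> third_wheels D' (f x) (f z)"
  using assms nbhd_ordinal_injection_verts[OF assms(1)] nbhd_ordinal_injection_nbrs[OF assms(1)]
  by (auto simp: third_wheels_def mutual_friends_def)

lemma G_set_image:
  assumes D: "out_ordered_digraph D" and f: "nbhd_ordinal_injection D D' f"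
    and xz: "mutual_friends D x z"
  shows "f ` G_set D x z \<subseteq> G_set D' (f x) (f z)"
proof -
  \<comment> \<open>Stated for a general pair \<open>u\<close>, \<open>v\<close> so as to serve both
    conditions of \<open>G_set\<close>, with \<open>(x, z)\<close> and with
    \<open>(z, x)\<close>.\<close>
  have less: "out_less D' (f u) (f v) (f y)"
    if "u \<in> ood_verts D" "v \<in> out_nbrs D u" "y \<in> ood_verts D"
      "y \<in> out_nbrs D u \<longrightarrow> out_less D u v y" "f y \<in> out_nbrs D' (f u)" for u v y
  proof (cases "y \<in> out_nbrs D u")
    case True
    then show ?thesis
      using nbhd_ordinal_injection_less[OF f D] that by blast
  next
    case False
    \<comment> \<open>Injectivity on vertices is what makes \<open>f y\<close> a new out-neighbour
      here.\<close>
    then have "f y \<notin> f ` out_nbrs D u"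
      using that out_ordered_digraph_nbrs[OF D] nbhd_ordinal_injection_eq_iff[OF f] by auto
    then show ?thesis
      using nbhd_ordinal_injection_new[OF f] that by blast
  qed
  show ?thesis
  proof
    fix w assume "w \<in> f ` G_set D x z"
    then obtain y where y: "y \<in> G_set D x z" "w = f y" by blast
    then have "y \<in> third_wheels D x z" by (simp add: G_set_def)
    then have "f y \<in> third_wheels D' (f x) (f z)" "y \<in> ood_verts D"
      using third_wheels_image[OF f xz] by (auto simp: third_wheels_def)
    then show "w \<in> G_set D' (f x) (f z)"
      using y xz less[of x z y] less[of z x y] by (auto simp: G_set_def mutual_friends_def)
  qed
qed

text \<open>An infinite \<open>B\<close> gives the bound \<open>\<infinity>\<close>; a finite
  \<open>B\<close> forces \<open>A\<close> to be finite, and ordinary cardinalities compare.\<close>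

lemma ecard_le_of_inj_on:
  assumes "inj_on f A" "f ` A \<subseteq> B"
  shows "ecard A \<le> ecard B"
  using assms by (auto simp: ecard_def card_inj_on_le inj_on_finite)

lemma mutual_friends_commute: "mutual_friends D x z \<longleftrightarrow> mutual_friends D z x"
  by (auto simp: mutual_friends_def)

text \<open>An unordered pair fixes its ends only up to exchange, which mutual friendship does not
  notice.\<close>

lemma linkage_graph_edge_iff: "{x, z} \<in> gedges (linkage_graph D) \<longleftrightarrow> mutual_friends D x z"
  by (auto simp: linkage_graph_def doubleton_eq_iff mutual_friends_commute)

lemma linkage_graph_weight:
  assumes "mutual_friends D x z"
  shows "gweight (linkage_graph D) {x, z} = ecard (G_set D x z)"
proof -
  \<comment> \<open>The weight function is restricted to edges, so this membership must be known
    before it can be evaluated.\<close>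
  have "{x, z} \<in> {{x, z} | x z. mutual_friends D x z}"
    using assms by blast
  then show ?thesis
    by (simp add: linkage_graph_def in_sway_pair)
qed

lemma edge_weighted_graph_linkage_graph: "edge_weighted_graph (linkage_graph D)"
  by (auto simp: edge_weighted_graph_def is_graph_def linkage_graph_def mutual_friends_def)

lemma edge_expansive_hom_linkage_graph:
  assumes D: "out_ordered_digraph D" and f: "nbhd_ordinal_injection D D' f"
  shows "edge_expansive_hom (linkage_graph D) (linkage_graph D') f"
proof -
  have "ecard (G_set D x z) \<le> ecard (G_set D' (f x) (f z))" if "mutual_friends D x z" for x z
  proof (rule ecard_le_of_inj_on)
    \<comment> \<open>Injectivity of \<open>f\<close> is known only on vertices.\<close>
    have "G_set D x z \<subseteq> ood_verts D"
      by (auto simp: G_set_def third_wheels_def)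
    then show "inj_on f (G_set D x z)"
      using f inj_on_subset by (auto simp: nbhd_ordinal_injection_def)
  qed (rule G_set_image[OF D f that])
  moreover have "f \<in> gverts (linkage_graph D) \<rightarrow> gverts (linkage_graph D')"
    using f by (simp add: nbhd_ordinal_injection_def linkage_graph_def)
  ultimately show ?thesis
    by (simp add: edge_expansive_hom_def linkage_graph_edge_iff linkage_graph_weight
        mutual_friends_image[OF f])
qed

lemma is_functor_Linkage: "is_functor OOD WGra Linkage"
  using is_category_OOD is_category_WGra unfolding OOD_def WGra_def
  by (rule is_functor_concrete_category)
    (auto simp: Linkage_def edge_weighted_graph_linkage_graph edge_expansive_hom_linkage_graph,
     auto simp: linkage_graph_def)

section \<open>The symmetric interior\<close>

text \<open>Having arcs in both directions makes each end the tail of an arc, hence a vertex, as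
  \<open>mutual_friends\<close> demands.\<close>

lemma symmetric_interior_ood_digraph:
  "symmetric_interior (ood_digraph D) =
     \<lparr>pverts = ood_verts D, parcs = {(x, y). mutual_friends D x y}\<rparr>"
  by (auto simp: symmetric_interior_def ood_digraph_def mutual_friends_def)

lemma symmetric_digraph_linkage_graph:
  "symmetric_digraph (forget_weights (linkage_graph D)) = symmetric_interior (ood_digraph D)"
proof -
  have "gedges (forget_weights (linkage_graph D)) = gedges (linkage_graph D)"
    "gverts (forget_weights (linkage_graph D)) = ood_verts D"
    by (simp_all add: forget_weights_def linkage_graph_def)
  then show ?thesis
    by (simp add: symmetric_digraph_def symmetric_interior_ood_digraph linkage_graph_edge_iff)
qed

text \<open>Formulated for any \<open>F\<close> with these object and morphism maps, so that it
  covers both composites in the comparison of functors.\<close>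

lemma is_functor_symmetric_interior:
  assumes "ObMap F = (\<lambda>D. symmetric_interior (ood_digraph D))" "MorMap F = (\<lambda>_ _ f. f)"
  shows "is_functor OOD SymDigra F"
  using is_category_OOD is_category_SymDigra unfolding OOD_def SymDigra_def
proof (rule is_functor_concrete_category)
  fix X :: "'a ood"
  show "ObMap F X \<in> {G. sym_digraph (with_proj G)}"
    by (auto simp: assms symmetric_interior_ood_digraph sym_digraph_with_proj_iff
        mutual_friends_def intro: symI)
  show "pverts (ObMap F X) = ood_verts X"
    by (simp add: assms symmetric_interior_ood_digraph)
next
  fix X Y :: "'a ood" and f
  assume "nbhd_ordinal_injection X Y f"
  then show "digraph_hom (ObMap F X) (ObMap F Y) f"
    by (auto simp: assms symmetric_interior_ood_digraph digraph_hom_def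
        mutual_friends_image nbhd_ordinal_injection_verts)
qed (fact assms)

text \<open>With its counterpart for \<open>SymInterior\<close>, this brings both composites to the
  same object and morphism maps, from which their agreement is immediate.\<close>

lemma functor_comp_linkage:
  "ObMap (AsSymmetric \<circ>\<^sub>F Forget \<circ>\<^sub>F Linkage) = (\<lambda>D. symmetric_interior (ood_digraph D))"
  "MorMap (AsSymmetric \<circ>\<^sub>F Forget \<circ>\<^sub>F Linkage) = (\<lambda>_ _ f. f)"
  by (simp_all add: functor_comp_def AsSymmetric_def Forget_def Linkage_def
      symmetric_digraph_linkage_graph)

lemma functor_comp_interior:
  "ObMap (SymInterior \<circ>\<^sub>F Digraph_of) = (\<lambda>D. symmetric_interior (ood_digraph D))"
  "MorMap (SymInterior \<circ>\<^sub>F Digraph_of) = (\<lambda>_ _ f. f)"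
  by (simp_all add: functor_comp_def SymInterior_def Digraph_of_def)

theorem theorem5p29:
  shows "(\<forall>(D :: 'a ood) (D' :: 'b ood) \<iota>.
            out_ordered_digraph D \<longrightarrow> out_ordered_digraph D' \<longrightarrow> nbhd_ordinal_injection D D' \<iota> \<longrightarrow>
            edge_expansive_hom (linkage_graph D) (linkage_graph D') \<iota>)
       \<and> is_functor (OOD :: ('c ood, 'c \<Rightarrow> 'c) category) WGra Linkage
       \<and> (\<forall>D :: 'c ood. out_ordered_digraph D \<longrightarrow>
            symmetric_digraph (forget_weights (linkage_graph D)) = symmetric_interior (ood_digraph D) \<and>
            symmetric_interior (ood_digraph D) =
              \<lparr>pverts = ood_verts D,
               parcs = {(x, y). x \<in> ood_verts D \<and> y \<in> ood_verts D \<and>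
                                y \<in> out_nbrs D x \<and> x \<in> out_nbrs D y}\<rparr>)
       \<and> is_functor (OOD :: ('c ood, 'c \<Rightarrow> 'c) category) SymDigra
           (AsSymmetric \<circ>\<^sub>F Forget \<circ>\<^sub>F Linkage)
       \<and> is_functor (OOD :: ('c ood, 'c \<Rightarrow> 'c) category) SymDigra
           (SymInterior \<circ>\<^sub>F Digraph_of)
       \<and> functors_agree (OOD :: ('c ood, 'c \<Rightarrow> 'c) category)
           (AsSymmetric \<circ>\<^sub>F Forget \<circ>\<^sub>F Linkage) (SymInterior \<circ>\<^sub>F Digraph_of)
       \<and> (\<forall>(D :: 'c ood) D' \<iota>.
            out_ordered_digraph D \<longrightarrow> out_ordered_digraph D' \<longrightarrow> \<iota> \<in> Hom OOD D D' \<longrightarrow>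
            MorMap (AsSymmetric \<circ>\<^sub>F Forget \<circ>\<^sub>F Linkage) D D' \<iota> = \<iota> \<and>
            MorMap (SymInterior \<circ>\<^sub>F Digraph_of) D D' \<iota> = \<iota>)"
proof (intro conjI allI impI)
  fix D :: "'c ood"
  show "symmetric_interior (ood_digraph D) =
      \<lparr>pverts = ood_verts D,
       parcs = {(x, y). x \<in> ood_verts D \<and> y \<in> ood_verts D \<and>
                        y \<in> out_nbrs D x \<and> x \<in> out_nbrs D y}\<rparr>"
    by (simp add: symmetric_interior_ood_digraph mutual_friends_def)
qed (simp_all add: edge_expansive_hom_linkage_graph is_functor_Linkage
    symmetric_digraph_linkage_graph is_functor_symmetric_interior functors_agree_def
    functor_comp_linkage functor_comp_interior)

end
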